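(* Let $m\ge 3$. Then (i) $\gamma_s(C_n\times K_m)=n$ for every $n\ge 3$; and (ii) $\gamma_s(C_2\times K_m)=3$ if $m=3$, and $\gamma_s(C_2\times K_m)=4$ if $m\ge 4$.
   Context: $C_n$ is the cycle on $\{1,\dots,n\}$ with edges $\{i,i+1\}$ and $\{n,1\}$, where $C_2$ is understood as the graph on $\{1,2\}$ with the single edge $\{1,2\}$; $K_m$ is the complete graph on $\{1,\dots,m\}$. The direct product $G\times H$ has vertex set $V(G)\times V(H)$ with $(g_1,h_1)\sim(g_2,h_2)$ iff $g_1g_2\in E(G)$ and $h_1h_2\in E(H)$. A set $D$ is dominating if every vertex not in $D$ is adjacent to a vertex of $D$. A set $S$ is a secure dominating set if it is dominating and for every vertex $w\notin S$ there is a neighbor $v\in S$ of $w$ such that $(S\setminus\{v\})\cup\{w\}$ is dominating; $\gamma_s(G)$ is the minimum size of a secure dominating set. *)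

theory Defs
  imports Main
begin

record 'a graph =
  verts :: "'a set"
  edges :: "'a set set"

definition adj :: "'a graph \<Rightarrow> 'a \<Rightarrow> 'a \<Rightarrow> bool" where
  "adj G u v \<longleftrightarrow> {u, v} \<in> edges G"

text \<open>Since edges are sets, \<open>cycle_graph 2\<close> has the single edge \<open>{1, 2}\<close>.
  Only \<open>n \<ge> 2\<close> is meaningful.\<close>

definition cycle_graph :: "nat \<Rightarrow> nat graph" where
  "cycle_graph n =
     \<lparr>verts = {1..n}, edges = {{i, i + 1} | i. 1 \<le> i \<and> i < n} \<union> {{n, 1}}\<rparr>"

definition complete_graph :: "nat \<Rightarrow> nat graph" where
  "complete_graph m =
     \<lparr>verts = {1..m}, edges = {{i, j} | i j. i \<in> {1..m} \<and> j \<in> {1..m} \<and> i \<noteq> j}\<rparr>"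

definition direct_product :: "'a graph \<Rightarrow> 'b graph \<Rightarrow> ('a \<times> 'b) graph" where
  "direct_product G H =
     \<lparr>verts = verts G \<times> verts H,
      edges = {{(g1, h1), (g2, h2)} | g1 h1 g2 h2. {g1, g2} \<in> edges G \<and> {h1, h2} \<in> edges H}\<rparr>"

definition dominating :: "'a graph \<Rightarrow> 'a set \<Rightarrow> bool" where
  "dominating G D \<longleftrightarrow>
     D \<subseteq> verts G \<and> (\<forall>w \<in> verts G - D. \<exists>v \<in> D. adj G w v)"

definition secure_dominating :: "'a graph \<Rightarrow> 'a set \<Rightarrow> bool" where
  "secure_dominating G S \<longleftrightarrow>
     dominating G S \<and>
     (\<forall>w \<in> verts G - S. \<exists>v \<in> S. adj G w v \<and> dominating G ((S - {v}) \<union> {w}))"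

text \<open>Finiteness is required because \<open>card\<close> of an infinite set is \<open>0\<close>.\<close>

definition secure_domination_number :: "'a graph \<Rightarrow> nat" where
  "secure_domination_number G =
     (LEAST k. \<exists>S. finite S \<and> secure_dominating G S \<and> card S = k)"

end

theory Submission
  imports Defs
begin

text \<open>
  Call the copy of \<open>K\<^sub>m\<close> over a vertex of the cycle a layer, and let \<open>s i\<close> be the number of
  vertices of a secure dominating set in layer \<open>i\<close>. If \<open>s (i - 1) + s (i + 1) \<ge> 2\<close> for all \<open>i\<close>,
  summing gives at least \<open>n\<close> vertices. Where this fails, some vertex of layer \<open>i\<close> can only be
  defended by the single neighbour, which leaves layer \<open>i\<close> without neighbours; so layer \<open>i\<close> is full
  up to at most one vertex, and nearby layers have surplus. A discharging argument along the
  cycle then restores the bound. The set \<open>V \<times> {1}\<close> attains it.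
\<close>

section \<open>Discharging along a permutation of the layers\<close>

locale cyclic_shift =
  fixes V :: "'a set" and \<sigma> \<tau> :: "'a \<Rightarrow> 'a"
  assumes finite_V: "finite V"
    and shift_in: "i \<in> V \<Longrightarrow> \<sigma> i \<in> V" "i \<in> V \<Longrightarrow> \<tau> i \<in> V"
    and shift_inverse: "i \<in> V \<Longrightarrow> \<tau> (\<sigma> i) = i" "i \<in> V \<Longrightarrow> \<sigma> (\<tau> i) = i"
begin

lemma bij_shift: "bij_betw \<sigma> V V" "bij_betw \<tau> V V"
  by (rule bij_betw_byWitness[where f' = \<tau>] bij_betw_byWitness[where f' = \<sigma>];
      auto simp: shift_in shift_inverse)+

text \<open>This is the conservation law behind discharging: moving charge by a fixed offset leaves
  the total unchanged.\<close>

lemma sum_shift: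
  fixes f :: "'a \<Rightarrow> nat"
  shows "(\<Sum>i\<in>V. f (\<sigma> i)) = (\<Sum>i\<in>V. f i)" "(\<Sum>i\<in>V. f (\<tau> i)) = (\<Sum>i\<in>V. f i)"
  using bij_shift by (auto intro: sum.reindex_bij_betw)

text \<open>A layer \<open>i\<close> needs neighbour sum 2. A layer with at least 3 vertices and smaller neighbour
  sum takes one unit from both neighbours. In a pattern \<open>0, 2, 1\<close> the middle layer takes one unit
  from the layer with one vertex or, if the layer after that is empty, from that empty one.\<close>

lemma card_le_sum_by_discharging:
  fixes s :: "'a \<Rightarrow> nat"
  assumes le1: "\<And>i. i \<in> V \<Longrightarrow> s i \<le> 1 \<Longrightarrow> 2 \<le> s (\<sigma> i) + s (\<tau> i)"
    and eq2: "\<And>i. i \<in> V \<Longrightarrow> s i = 2 \<Longrightarrow> 1 \<le> s (\<sigma> i) + s (\<tau> i)"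
    and right: "\<And>i. i \<in> V \<Longrightarrow> s i = 2 \<Longrightarrow> s (\<tau> i) = 0 \<Longrightarrow> s (\<sigma> i) = 1 \<Longrightarrow>
                  1 \<le> s (\<sigma> (\<sigma> i)) \<or> 2 \<le> s (\<sigma> (\<sigma> (\<sigma> i)))"
    and left: "\<And>i. i \<in> V \<Longrightarrow> s i = 2 \<Longrightarrow> s (\<sigma> i) = 0 \<Longrightarrow> s (\<tau> i) = 1 \<Longrightarrow>
                  1 \<le> s (\<tau> (\<tau> i)) \<or> 2 \<le> s (\<tau> (\<tau> (\<tau> i)))"
  shows "card V \<le> (\<Sum>i\<in>V. s i)"
proof -
  \<comment> \<open>The letter is the direction and the digit the distance of the layer from which
    \<open>i\<close> draws a unit: \<open>R1 i\<close> is drawn from \<open>\<sigma> i\<close>,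
    \<open>L2 i\<close> from \<open>\<tau> (\<tau> i)\<close>.\<close>
  define R1 L1 R2 L2 :: "'a \<Rightarrow> nat" where
    "R1 = (\<lambda>i. if 3 \<le> s i \<and> s (\<sigma> i) + s (\<tau> i) \<le> 1 \<or>
                  s (\<tau> i) = 0 \<and> s i = 2 \<and> s (\<sigma> i) = 1 \<and> 1 \<le> s (\<sigma> (\<sigma> i)) then 1 else 0)"
    and "L1 = (\<lambda>i. if 3 \<le> s i \<and> s (\<sigma> i) + s (\<tau> i) \<le> 1 \<or>
                  s (\<sigma> i) = 0 \<and> s i = 2 \<and> s (\<tau> i) = 1 \<and> 1 \<le> s (\<tau> (\<tau> i)) then 1 else 0)"
    and "R2 = (\<lambda>i. if s (\<tau> i) = 0 \<and> s i = 2 \<and> s (\<sigma> i) = 1 \<and> s (\<sigma> (\<sigma> i)) = 0 then 1 else 0)"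
    and "L2 = (\<lambda>i. if s (\<sigma> i) = 0 \<and> s i = 2 \<and> s (\<tau> i) = 1 \<and> s (\<tau> (\<tau> i)) = 0 then 1 else 0)"
  note defs = R1_def L1_def R2_def L2_def
  have balance: "2 + (R1 (\<tau> i) + L1 (\<sigma> i) + R2 (\<tau> (\<tau> i)) + L2 (\<sigma> (\<sigma> i)))
      \<le> s (\<sigma> i) + s (\<tau> i) + (R1 i + L1 i + R2 i + L2 i)" if i: "i \<in> V" for i
  proof -
    \<comment> \<open>\<open>right\<close> is read two layers back. If \<open>R2\<close> draws on
      the empty layer \<open>i\<close>, then \<open>\<sigma> i\<close> holds at least two vertices,
      and together with the one in \<open>\<tau> i\<close> this leaves a unit to spare.\<close>
    have r: "s (\<tau> (\<tau> i)) = 2 \<Longrightarrow> s (\<tau> (\<tau> (\<tau> i))) = 0 \<Longrightarrow> s (\<tau> i) = 1 \<Longrightarrow> 1 \<le> s i \<or> 2 \<le> s (\<sigma> i)"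
      using right[of "\<tau> (\<tau> i)"] i by (simp add: shift_in shift_inverse)
    have l: "s (\<sigma> (\<sigma> i)) = 2 \<Longrightarrow> s (\<sigma> (\<sigma> (\<sigma> i))) = 0 \<Longrightarrow> s (\<sigma> i) = 1 \<Longrightarrow> 1 \<le> s i \<or> 2 \<le> s (\<tau> i)"
      using left[of "\<sigma> (\<sigma> i)"] i by (simp add: shift_in shift_inverse)
    show ?thesis
    proof (cases "s i \<le> 1")
      case True
      \<comment> \<open>Each possible unit drawn from \<open>i\<close> is recorded with the
        neighbour sizes that it forces; in every compatible combination these sizes cover the demand
        2 and all units drawn.\<close>
      have "R1 (\<tau> i) = 0 \<or>
          R1 (\<tau> i) = 1 \<and> (3 \<le> s (\<tau> i) \<or> s (\<tau> i) = 2 \<and> s i = 1 \<and> 1 \<le> s (\<sigma> i))"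
        using i by (simp add: R1_def shift_inverse)
      moreover have "L1 (\<sigma> i) = 0 \<or>
          L1 (\<sigma> i) = 1 \<and> (3 \<le> s (\<sigma> i) \<or> s (\<sigma> i) = 2 \<and> s i = 1 \<and> 1 \<le> s (\<tau> i))"
        using i by (simp add: L1_def shift_inverse)
      moreover have "R2 (\<tau> (\<tau> i)) = 0 \<or>
          R2 (\<tau> (\<tau> i)) = 1 \<and> s i = 0 \<and> s (\<tau> i) = 1 \<and> 2 \<le> s (\<sigma> i)"
        using i r by (simp add: R2_def shift_in shift_inverse) presburger
      moreover have "L2 (\<sigma> (\<sigma> i)) = 0 \<or>
          L2 (\<sigma> (\<sigma> i)) = 1 \<and> s i = 0 \<and> s (\<sigma> i) = 1 \<and> 2 \<le> s (\<tau> i)"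
        using i l by (simp add: L2_def shift_in shift_inverse) presburger
      ultimately show ?thesis
        using le1[OF i True] by (elim disjE conjE; linarith)
    next
      case False
      \<comment> \<open>Only layers with at most one vertex are ever drawn on.\<close>
      then have "R1 (\<tau> i) = 0" "L1 (\<sigma> i) = 0" "R2 (\<tau> (\<tau> i)) = 0" "L2 (\<sigma> (\<sigma> i)) = 0"
        using i by (simp_all add: defs shift_in shift_inverse)
      moreover have "2 \<le> s (\<sigma> i) + s (\<tau> i) + (R1 i + L1 i + R2 i + L2 i)"
      proof (cases "s i = 2")
        case True
        \<comment> \<open>In the last two cases exactly one unit is missing. It comes from distance
          1 or 2, according to whether the layer beyond the single vertex is nonempty or
          empty.\<close>
        then consider "2 \<le> s (\<sigma> i) + s (\<tau> i)" | "s (\<sigma> i) = 1" "s (\<tau> i) = 0"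
          | "s (\<sigma> i) = 0" "s (\<tau> i) = 1"
          using eq2[OF i True] by linarith
        then show ?thesis by cases (use True in \<open>auto simp: defs\<close>)
      next
        case False
        then show ?thesis using \<open>\<not> s i \<le> 1\<close> by (simp add: R1_def L1_def)
      qed
      ultimately show ?thesis by simp
    qed
  qed
  have "(\<Sum>i\<in>V. 2 + (R1 (\<tau> i) + L1 (\<sigma> i) + R2 (\<tau> (\<tau> i)) + L2 (\<sigma> (\<sigma> i))))
      \<le> (\<Sum>i\<in>V. s (\<sigma> i) + s (\<tau> i) + (R1 i + L1 i + R2 i + L2 i))"
    by (intro sum_mono balance)
  \<comment> \<open>All transfers cancel and each \<open>s i\<close> is counted twice, so twice
    \<open>card V\<close> is at most twice the sum.\<close>
  then show ?thesis
    using sum_shift(2)[of "\<lambda>i. R2 (\<tau> i)"] sum_shift(1)[of "\<lambda>i. L2 (\<sigma> i)"]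
    by (simp only: sum.distrib sum_shift sum_constant) simp
qed

end

section \<open>Layers of a product with a complete graph, and the effect of a defending swap\<close>

lemma direct_product_complete_edge_iff:
  "adj (direct_product G (complete_graph m)) (i, h) (j, k) \<longleftrightarrow>
     {i, j} \<in> edges G \<and> h \<in> {1..m} \<and> k \<in> {1..m} \<and> h \<noteq> k"
proof -
  have "adj (direct_product G K) (i, h) (j, k) \<longleftrightarrow> {i, j} \<in> edges G \<and> {h, k} \<in> edges K" for K
    unfolding adj_def direct_product_def by (auto simp: doubleton_eq_iff insert_commute)
  moreover have "{h, k} \<in> edges (complete_graph m) \<longleftrightarrow> h \<in> {1..m} \<and> k \<in> {1..m} \<and> h \<noteq> k"
    unfolding complete_graph_def by (auto simp: doubleton_eq_iff)
  ultimately show ?thesis by simp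
qed

lemma secure_domination_number_eqI:
  assumes "secure_dominating G S" "finite S"
    and "\<And>T. secure_dominating G T \<Longrightarrow> finite T \<Longrightarrow> card S \<le> card T"
  shows "secure_domination_number G = card S"
  unfolding secure_domination_number_def
  by (rule Least_equality) (use assms in auto)

definition layer :: "('a \<times> nat) set \<Rightarrow> 'a \<Rightarrow> nat set" where
  "layer D i = {h. (i, h) \<in> D}"

text \<open>The two maps give the neighbours of a vertex. They may agree, which covers the cycle on
  two vertices.\<close>

locale shift_graph = cyclic_shift "verts G" \<sigma> \<tau>
  for G :: "'a graph" and \<sigma> \<tau> :: "'a \<Rightarrow> 'a" +
  fixes m :: nat
  assumes edge_iff: "i \<in> verts G \<Longrightarrow> {i, j} \<in> edges G \<longleftrightarrow> j = \<sigma> i \<or> j = \<tau> i"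
    and no_fixpoint: "i \<in> verts G \<Longrightarrow> \<sigma> i \<noteq> i" "i \<in> verts G \<Longrightarrow> \<tau> i \<noteq> i"
    and m_ge_3: "m \<ge> 3"
begin

abbreviation H where "H \<equiv> direct_product G (complete_graph m)"

text \<open>Exchanging the two directions yields the left-handed version of every one-sided
  lemma.\<close>

lemma mirror: "shift_graph G \<tau> \<sigma> m"
  by unfold_locales (auto simp: finite_V shift_in shift_inverse edge_iff no_fixpoint m_ge_3)

lemma verts_H: "verts H = verts G \<times> {1..m}"
  by (simp add: direct_product_def complete_graph_def)

lemma adj_iff:
  "i \<in> verts G \<Longrightarrow> adj H (i, h) (j, k) \<longleftrightarrow>
     (j = \<sigma> i \<or> j = \<tau> i) \<and> h \<in> {1..m} \<and> k \<in> {1..m} \<and> h \<noteq> k"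
  by (simp add: direct_product_complete_edge_iff edge_iff)

lemma dominating_iff:
  "dominating H D \<longleftrightarrow> D \<subseteq> verts G \<times> {1..m} \<and>
     (\<forall>i\<in>verts G. \<forall>h\<in>{1..m}. (i, h) \<in> D \<or> (\<exists>k. k \<noteq> h \<and> ((\<sigma> i, k) \<in> D \<or> (\<tau> i, k) \<in> D)))"
  (is "_ \<longleftrightarrow> _ \<and> ?R")
proof (cases "D \<subseteq> verts G \<times> {1..m}")
  case True
  then have in_m: "(j, k) \<in> D \<Longrightarrow> k \<in> {1..m}" for j k by auto
  have "(\<exists>v\<in>D. adj H (i, h) v) \<longleftrightarrow> (\<exists>k. k \<noteq> h \<and> ((\<sigma> i, k) \<in> D \<or> (\<tau> i, k) \<in> D))"
    if "i \<in> verts G" "h \<in> {1..m}" for i h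
  proof -
    have "(\<exists>v\<in>D. adj H (i, h) v) \<longleftrightarrow> (\<exists>j k. (j, k) \<in> D \<and> adj H (i, h) (j, k))"
      by auto
    also have "\<dots> \<longleftrightarrow> (\<exists>j k. (j, k) \<in> D \<and> (j = \<sigma> i \<or> j = \<tau> i) \<and> k \<in> {1..m} \<and> h \<noteq> k)"
      using that by (simp only: adj_iff) auto
    also have "\<dots> \<longleftrightarrow> (\<exists>k. k \<noteq> h \<and> ((\<sigma> i, k) \<in> D \<or> (\<tau> i, k) \<in> D))"
      using in_m by metis
    finally show ?thesis .
  qed
  then show ?thesis
    using True unfolding dominating_def verts_H by (auto simp: Ball_def)
next
  case False
  then show ?thesis by (simp add: dominating_def verts_H)
qed

lemma layer_subset: "dominating H D \<Longrightarrow> layer D i \<subseteq> {1..m}"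
  by (auto simp: dominating_iff layer_def)

lemma finite_layer: "dominating H D \<Longrightarrow> finite (layer D i)"
  using layer_subset finite_subset by blast

lemma card_eq_sum_layers:
  assumes "dominating H D"
  shows "card D = (\<Sum>i\<in>verts G. card (layer D i))"
proof -
  have "D = Sigma (verts G) (layer D)"
    using assms by (auto simp: dominating_iff layer_def)
  then show ?thesis
    using card_SigmaI[of "verts G" "layer D"] finite_V finite_layer[OF assms] by simp
qed

lemma dominated:
  assumes "dominating H D" "i \<in> verts G" "h \<in> {1..m}" "h \<notin> layer D i"
  shows "\<exists>k. k \<noteq> h \<and> k \<in> layer D (\<sigma> i) \<union> layer D (\<tau> i)"
  using assms unfolding dominating_iff layer_def by blast

text \<open>If all vertices in the neighbouring layers had the same second coordinate
  \<open>k\<close>, nothing would dominate \<open>(i, k)\<close>.\<close>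

lemma empty_layer:
  assumes D: "dominating H D" and i: "i \<in> verts G" and e: "layer D i = {}"
  shows "2 \<le> card (layer D (\<sigma> i) \<union> layer D (\<tau> i))"
proof -
  have "1 \<in> {1..m}" using m_ge_3 by simp
  then obtain k where k: "k \<in> layer D (\<sigma> i) \<union> layer D (\<tau> i)"
    using dominated[OF D i, of 1] e by blast
  then have "k \<in> {1..m}" using layer_subset[OF D] by blast
  then obtain l where l: "l \<noteq> k" "l \<in> layer D (\<sigma> i) \<union> layer D (\<tau> i)"
    using dominated[OF D i, of k] e by blast
  have "card {k, l} \<le> card (layer D (\<sigma> i) \<union> layer D (\<tau> i))"
    by (rule card_mono) (use k l finite_layer[OF D] in auto)
  then show ?thesis using l by simp
qed

lemma neighbours_nonempty:
  assumes D: "dominating H D" and i: "i \<in> verts G" and s: "card (layer D i) < m"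
  shows "layer D (\<sigma> i) \<union> layer D (\<tau> i) \<noteq> {}"
proof -
  have "layer D i \<noteq> {1..m}" using s by auto
  then obtain h where "h \<in> {1..m}" "h \<notin> layer D i" using layer_subset[OF D] by blast
  then show ?thesis using dominated[OF D i] by blast
qed

text \<open>A vertex missing from layer \<open>i\<close> must be defended from a neighbouring layer,
  where \<open>k\<close> is the only second coordinate present.\<close>

lemma swap_of_single_neighbour:
  assumes S: "secure_dominating H S" and i: "i \<in> verts G" and s: "card (layer S i) < m"
    and N: "layer S (\<sigma> i) \<union> layer S (\<tau> i) = {k}"
  obtains j h where "j = \<sigma> i \<or> j = \<tau> i" "k \<in> layer S j" "h \<in> {1..m} - layer S i"
    "dominating H (S - {(j, k)} \<union> {(i, h)})"
proof -
  have D: "dominating H S" using S by (simp add: secure_dominating_def)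
  have "layer S i \<noteq> {1..m}" using s by auto
  then obtain h where h: "h \<in> {1..m}" "h \<notin> layer S i" using layer_subset[OF D] by blast
  then have "(i, h) \<in> verts H - S" using i by (auto simp: verts_H layer_def)
  then obtain j k' where v: "(j, k') \<in> S" "adj H (i, h) (j, k')"
      "dominating H (S - {(j, k')} \<union> {(i, h)})"
    using S unfolding secure_dominating_def by (metis surj_pair)
  then have "j = \<sigma> i \<or> j = \<tau> i" using adj_iff[OF i] by blast
  moreover from this have "k' = k" using v(1) N by (auto simp: layer_def)
  ultimately show ?thesis using that v h by (auto simp: layer_def)
qed

text \<open>By \<open>one\<close>, the defender is the only vertex in the layers next to
  \<open>i\<close>. The swap empties them, so layer \<open>i\<close> must then be full, and it has
  gained only \<open>h\<close>.\<close>

lemma almost_full_of_card_neighbours_1: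
  assumes S: "secure_dominating H S" and i: "i \<in> verts G" and s: "card (layer S i) < m"
    and N: "layer S (\<sigma> i) \<union> layer S (\<tau> i) = {k}"
    and one: "\<sigma> i = \<tau> i \<or> layer S (\<sigma> i) = {} \<or> layer S (\<tau> i) = {}"
  shows "m \<le> card (layer S i) + 1"
proof -
  obtain j h where j: "j = \<sigma> i \<or> j = \<tau> i" "k \<in> layer S j" and h: "h \<in> {1..m} - layer S i"
    and D: "dominating H (S - {(j, k)} \<union> {(i, h)})"
    using swap_of_single_neighbour[OF S i s N] .
  let ?D = "S - {(j, k)} \<union> {(i, h)}"
  have "layer ?D (\<sigma> i) \<union> layer ?D (\<tau> i) = {}"
    using j N one no_fixpoint[OF i] by (auto simp: layer_def)
  then have "\<not> card (layer ?D i) < m" using neighbours_nonempty[OF D i] by blast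
  moreover have "layer ?D i = insert h (layer S i)"
    using j(1) no_fixpoint[OF i] by (auto simp: layer_def)
  ultimately show ?thesis using card_insert_le_m1[of "Suc (card (layer S i))" "layer S i" h]
    by simp
qed

text \<open>For the pattern 0, 2, 1, 0: a vertex missing from layer \<open>i\<close> is defended
  only by the single vertex of \<open>\<sigma> i\<close>. The swap empties that layer, so the empty
  layer after it must be dominated from its far side alone, which takes two vertices.\<close>

lemma swap_next_layer:
  assumes S: "secure_dominating H S" and i: "i \<in> verts G" and s: "card (layer S i) = 2"
    and "layer S (\<tau> i) = {}" "card (layer S (\<sigma> i)) = 1"
    and e: "layer S (\<sigma> (\<sigma> i)) = {}"
  shows "2 \<le> card (layer S (\<sigma> (\<sigma> (\<sigma> i))))"
\<comment> \<open>If three steps lead back to \<open>i\<close>, the layer in question is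
  \<open>layer S i\<close> itself, which has two vertices. Otherwise the inserted vertex does not
  lie in it.\<close>
proof (cases "\<sigma> (\<sigma> (\<sigma> i)) = i")
  case False
  obtain k where k: "layer S (\<sigma> i) = {k}" using assms(5) by (auto simp: card_1_singleton_iff)
  then have N: "layer S (\<sigma> i) \<union> layer S (\<tau> i) = {k}" using assms(4) by simp
  have s': "card (layer S i) < m" using s m_ge_3 by simp
  obtain j h where "j = \<sigma> i \<or> j = \<tau> i" "k \<in> layer S j"
    and D: "dominating H (S - {(j, k)} \<union> {(i, h)})"
    using swap_of_single_neighbour[OF S i s' N] .
  then have j: "j = \<sigma> i" using assms(4) by auto
  let ?D = "S - {(j, k)} \<union> {(i, h)}" and ?i2 = "\<sigma> (\<sigma> i)"
  have i2: "?i2 \<in> verts G" "\<tau> ?i2 = \<sigma> i" using i by (simp_all add: shift_in shift_inverse)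
  have "?i2 \<noteq> i" using s e by auto
  then have "layer ?D ?i2 = {}" using e by (auto simp: layer_def)
  from empty_layer[OF D i2(1) this]
  have "2 \<le> card (layer ?D (\<sigma> ?i2) \<union> layer ?D (\<sigma> i))" using i2 by simp
  moreover have "layer ?D (\<sigma> ?i2) \<union> layer ?D (\<sigma> i) \<subseteq> layer S (\<sigma> ?i2)"
    using False j k no_fixpoint[OF i] by (auto simp: layer_def)
  moreover have "finite (layer S (\<sigma> ?i2))"
    using S finite_layer by (auto simp: secure_dominating_def)
  ultimately show ?thesis by (meson card_mono le_trans)
qed (use s in simp)

section \<open>The bounds for layers in a cycle\<close>

lemma card_secure_dominating_ge:
  assumes S: "secure_dominating H S"
  shows "card (verts G) \<le> card S"
proof -
  let ?s = "\<lambda>i. card (layer S i)"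
  have D: "dominating H S" using S by (simp add: secure_dominating_def)
  note fin = finite_layer[OF D]
  interpret M: shift_graph G \<tau> \<sigma> m by (rule mirror)
  have ge1: "1 \<le> ?s (\<sigma> i) + ?s (\<tau> i)" if "i \<in> verts G" "?s i < m" for i
    using neighbours_nonempty[OF D that] fin by (auto simp: Suc_le_eq card_gt_0_iff)
  have "card (verts G) \<le> (\<Sum>i\<in>verts G. ?s i)"
  proof (rule card_le_sum_by_discharging)
    fix i assume i: "i \<in> verts G" and s: "?s i \<le> 1"
    then have lt: "?s i < m" using m_ge_3 by simp
    show "2 \<le> ?s (\<sigma> i) + ?s (\<tau> i)"
    proof (rule ccontr)
      assume "\<not> ?thesis"
      \<comment> \<open>A neighbour sum of 1 would force layer \<open>i\<close> to have at least
        \<open>m - 1\<close> vertices, hence at least 2.\<close>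
      then have "?s (\<sigma> i) = 1 \<and> ?s (\<tau> i) = 0 \<or> ?s (\<sigma> i) = 0 \<and> ?s (\<tau> i) = 1"
        using ge1[OF i lt] by linarith
      then obtain k where "layer S (\<sigma> i) \<union> layer S (\<tau> i) = {k}"
          "layer S (\<sigma> i) = {} \<or> layer S (\<tau> i) = {}"
        using fin by (auto simp: card_1_singleton_iff)
      then show False using almost_full_of_card_neighbours_1[OF S i lt] s m_ge_3 by fastforce
    qed
  next
    fix i assume i: "i \<in> verts G" and s: "?s i = 2"
    then show "1 \<le> ?s (\<sigma> i) + ?s (\<tau> i)" using ge1 m_ge_3 by simp
    show "1 \<le> ?s (\<sigma> (\<sigma> i)) \<or> 2 \<le> ?s (\<sigma> (\<sigma> (\<sigma> i)))" if "?s (\<tau> i) = 0" "?s (\<sigma> i) = 1"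
      using swap_next_layer[OF S i s] that fin by (auto simp: Suc_le_eq card_gt_0_iff)
    show "1 \<le> ?s (\<tau> (\<tau> i)) \<or> 2 \<le> ?s (\<tau> (\<tau> (\<tau> i)))" if "?s (\<sigma> i) = 0" "?s (\<tau> i) = 1"
      using M.swap_next_layer[OF S i] s that fin by (auto simp: Suc_le_eq card_gt_0_iff)
  qed
  then show ?thesis by (simp add: card_eq_sum_layers[OF D])
qed

text \<open>A vertex \<open>(i, h)\<close> outside the row is defended by
  \<open>(\<sigma> i, 1)\<close>. Since \<open>\<sigma> j\<close> and \<open>\<tau> j\<close>
  differ, every layer \<open>j\<close> still has a neighbouring layer with its row vertex.\<close>

lemma secure_dominating_row:
  assumes "\<And>i. i \<in> verts G \<Longrightarrow> \<sigma> i \<noteq> \<tau> i"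
  shows "secure_dominating H (verts G \<times> {1})"
  unfolding secure_dominating_def
proof (intro conjI ballI)
  show "dominating H (verts G \<times> {1})"
    using m_ge_3 by (auto simp: dominating_iff shift_in)
  fix w assume "w \<in> verts H - verts G \<times> {1}"
  moreover obtain i h where w: "w = (i, h)" by fastforce
  ultimately have i: "i \<in> verts G" and h: "h \<in> {1..m}" "h \<noteq> 1" by (auto simp: verts_H)
  have "adj H w (\<sigma> i, 1)" using w h m_ge_3 by (simp add: adj_iff[OF i])
  moreover have "dominating H (verts G \<times> {1} - {(\<sigma> i, 1)} \<union> {w})"
    unfolding dominating_iff
  proof (intro conjI ballI)
    show "verts G \<times> {1} - {(\<sigma> i, 1)} \<union> {w} \<subseteq> verts G \<times> {1..m}"
      using w i h m_ge_3 by auto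
    fix j l assume j: "j \<in> verts G" and l: "l \<in> {1..m}"
    let ?D = "verts G \<times> {1} - {(\<sigma> i, 1)} \<union> {w}"
    show "(j, l) \<in> ?D \<or> (\<exists>k. k \<noteq> l \<and> ((\<sigma> j, k) \<in> ?D \<or> (\<tau> j, k) \<in> ?D))"
    proof (cases "l = 1")
      case True
      show ?thesis
      proof (cases "j = \<sigma> i")
        case True
        \<comment> \<open>The only vertex to leave the row is dominated by the newcomer
          \<open>(i, h)\<close>, because \<open>h\<close> is not 1.\<close>
        then have "(\<tau> j, h) \<in> ?D" using w i by (simp add: shift_inverse)
        then show ?thesis using \<open>l = 1\<close> h by blast
      next
        case False
        then show ?thesis using True j by simp
      qed
    next
      case False
      have "(\<sigma> j, 1) \<in> ?D \<or> (\<tau> j, 1) \<in> ?D" using assms[OF j] j shift_in by auto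
      then show ?thesis using False by metis
    qed
  qed
  ultimately show "\<exists>v\<in>verts G \<times> {1}. adj H w v \<and> dominating H (verts G \<times> {1} - {v} \<union> {w})"
    using shift_in(1)[OF i] by blast
qed

lemma secure_domination_number_eq_card:
  assumes "\<And>i. i \<in> verts G \<Longrightarrow> \<sigma> i \<noteq> \<tau> i"
  shows "secure_domination_number H = card (verts G)"
proof -
  have "card (verts G \<times> {1::nat}) = card (verts G)" by (simp add: card_cartesian_product)
  then show ?thesis
    using secure_domination_number_eqI[OF secure_dominating_row[OF assms]]
      card_secure_dominating_ge finite_V by simp
qed

end

section \<open>Cycles, and the exceptional cycle on two vertices\<close>

lemma cycle_graph_edge_iff:
  "{i, j} \<in> edges (cycle_graph n) \<longleftrightarrow>
     1 \<le> i \<and> i < n \<and> j = i + 1 \<or> 1 \<le> j \<and> j < n \<and> i = j + 1 \<or> i = n \<and> j = 1 \<or> i = 1 \<and> j = n"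
  by (auto simp: cycle_graph_def doubleton_eq_iff)

lemma shift_graph_cycle:
  assumes "2 \<le> n" "3 \<le> m"
  shows "shift_graph (cycle_graph n) (\<lambda>i. if i = n then 1 else i + 1)
           (\<lambda>i. if i = 1 then n else i - 1) m"
proof unfold_locales
  fix i j assume "i \<in> verts (cycle_graph n)"
  then have i: "1 \<le> i" "i \<le> n" by (simp_all add: cycle_graph_def)
  show "{i, j} \<in> edges (cycle_graph n) \<longleftrightarrow>
      j = (if i = n then 1 else i + 1) \<or> j = (if i = 1 then n else i - 1)"
    unfolding cycle_graph_edge_iff using i assms(1)
    by (cases "i = n"; cases "i = 1"; simp; linarith)
qed (use assms in \<open>auto simp: cycle_graph_def\<close>)

text \<open>Here \<open>3 - i\<close> exchanges 1 and 2. Both shifts are this map, so each layer has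
  a single neighbouring layer.\<close>

locale two_layers = shift_graph "cycle_graph 2" "\<lambda>i. 3 - i" "\<lambda>i. 3 - i" m for m
begin

lemma verts_cycle_2: "verts (cycle_graph 2) = {1, 2}"
  by (auto simp: cycle_graph_def)

lemma dominating_2_iff:
  "dominating H D \<longleftrightarrow> D \<subseteq> {1, 2} \<times> {1..m} \<and>
     (\<forall>h\<in>{1..m}. ((1, h) \<in> D \<or> (\<exists>k. k \<noteq> h \<and> (2, k) \<in> D)) \<and>
                 ((2, h) \<in> D \<or> (\<exists>k. k \<noteq> h \<and> (1, k) \<in> D)))"
  unfolding dominating_iff verts_cycle_2 by auto

text \<open>With fewer than \<open>m\<close> and fewer than 4 vertices, neither layer is full, so
  neither is empty and one has a single vertex. The other then has at least \<open>m - 1\<close>,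
  giving \<open>m\<close> in total. For \<open>m \<ge> 3\<close>, \<open>min m 4\<close> merges the
  two values 3 and 4.\<close>

lemma card_secure_dominating_2_ge:
  assumes S: "secure_dominating H S"
  shows "min m 4 \<le> card S"
proof -
  let ?s = "\<lambda>i. card (layer S i)"
  have D: "dominating H S" using S by (simp add: secure_dominating_def)
  have pos: "?s i < m \<Longrightarrow> ?s (3 - i) \<noteq> 0" if "i \<in> {1, 2}" for i
    using neighbours_nonempty[OF D] that finite_layer[OF D] by (simp add: verts_cycle_2)
  have one: "m \<le> ?s i + 1" if "i \<in> {1, 2}" "?s i < m" "?s (3 - i) = 1" for i
  proof -
    obtain k where "layer S (3 - i) = {k}" using \<open>?s (3 - i) = 1\<close>
      by (auto simp: card_1_singleton_iff)
    then show ?thesis using almost_full_of_card_neighbours_1[OF S, of i k] that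
      by (simp add: verts_cycle_2)
  qed
  have card: "card S = ?s 1 + ?s 2"
    using card_eq_sum_layers[OF D] by (simp add: verts_cycle_2)
  show ?thesis
  proof (rule ccontr)
    assume "\<not> ?thesis"
    then have lt: "?s 1 + ?s 2 < m" "?s 1 + ?s 2 < 4" using card by simp_all
    moreover have "?s 1 \<noteq> 0" "?s 2 \<noteq> 0" using pos[of 1] pos[of 2] lt by simp_all
    ultimately consider "?s 1 = 1" | "?s 2 = 1" by linarith
    then show False using one[of 1] one[of 2] lt by cases simp_all
  qed
qed

lemma secure_dominating_2I:
  assumes "dominating H S"
    and "\<And>i h. i \<in> {1, 2} \<Longrightarrow> h \<in> {1..m} \<Longrightarrow> (i, h) \<notin> S \<Longrightarrow>
           \<exists>k. k \<noteq> h \<and> (3 - i, k) \<in> S \<and> dominating H (S - {(3 - i, k)} \<union> {(i, h)})"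
  shows "secure_dominating H S"
  unfolding secure_dominating_def
proof (intro conjI ballI)
  fix w assume "w \<in> verts H - S"
  then obtain i h where w: "w = (i, h)" and i: "i \<in> {1, 2}" and h: "h \<in> {1..m}" "(i, h) \<notin> S"
    by (auto simp: verts_H verts_cycle_2)
  then obtain k where k: "k \<noteq> h" "(3 - i, k) \<in> S" "dominating H (S - {(3 - i, k)} \<union> {(i, h)})"
    using assms(2) by blast
  moreover have "k \<in> {1..m}" using assms(1) k(2) by (auto simp: dominating_def verts_H)
  ultimately show "\<exists>v\<in>S. adj H w v \<and> dominating H (S - {v} \<union> {w})"
    using w i h by (intro bexI[of _ "(3 - i, k)"]) (auto simp: adj_iff verts_cycle_2)
qed (rule assms(1))

lemma secure_dominating_3:
  assumes "m = 3"
  shows "secure_dominating H {(1, 1), (1, 2), (2, 1)}"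
proof (rule secure_dominating_2I)
  have m: "{1..m} = {1, 2, 3}" using assms by auto
  show "dominating H {(1, 1), (1, 2), (2, 1)}"
    unfolding dominating_2_iff m by (auto simp: conj_disj_distribL ex_disj_distrib)
  fix i h :: nat
  assume "i \<in> {1, 2}" "h \<in> {1..m}" "(i, h) \<notin> {(1, 1), (1, 2), (2, 1)}"
  then consider "i = 1" "h = 3" | "i = 2" "h = 2" | "i = 2" "h = 3" unfolding m by auto
  then show "\<exists>k. k \<noteq> h \<and> (3 - i, k) \<in> {(1, 1), (1, 2), (2, 1)} \<and>
      dominating H ({(1, 1), (1, 2), (2, 1)} - {(3 - i, k)} \<union> {(i, h)})"
  proof cases
    case 1
    then show ?thesis unfolding dominating_2_iff m
      by (intro exI[of _ 1]) (auto simp: conj_disj_distribL ex_disj_distrib)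
  next
    case 2
    then show ?thesis unfolding dominating_2_iff m
      by (intro exI[of _ 1]) (auto simp: conj_disj_distribL ex_disj_distrib)
  next
    case 3
    \<comment> \<open>Moving \<open>(1, 1)\<close> instead would leave only \<open>(1, 2)\<close> in
      layer 1, and \<open>(2, 2)\<close> would be undominated.\<close>
    then show ?thesis unfolding dominating_2_iff m
      by (intro exI[of _ 2]) (auto simp: conj_disj_distribL conj_disj_distribR ex_disj_distrib)
  qed
qed

text \<open>The defender is taken from second coordinate 1. Both vertices with second coordinate 2
  stay, and they dominate every vertex with a different second coordinate.\<close>

lemma secure_dominating_4:
  "secure_dominating H ({1, 2} \<times> {1, 2})"
proof (rule secure_dominating_2I)
  show "dominating H ({1, 2} \<times> {1, 2})"
    using m_ge_3 unfolding dominating_2_iff by (auto simp: conj_disj_distribL ex_disj_distrib)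
  fix i h :: nat
  assume i: "i \<in> {1, 2}" and h: "h \<in> {1..m}" "(i, h) \<notin> {1, 2} \<times> {1, 2}"
  then have "h \<noteq> 1" "h \<noteq> 2" by auto
  then have "dominating H ({1, 2} \<times> {1, 2} - {(3 - i, 1)} \<union> {(i, h)})"
  proof -
    have eq: "{1, 2} \<times> {1, 2} - {(3 - i, 1)} \<union> {(i, h)} = {(i, 1), (i, 2), (i, h), (3 - i, 2)}"
      using i by auto
    have "dominating H {(1, 1), (1, 2), (1, h), (2, 2)}"
      using h m_ge_3 unfolding dominating_2_iff
      by (auto simp: conj_disj_distribL ex_disj_distrib)
    moreover have "dominating H {(2, 1), (2, 2), (2, h), (1, 2)}"
      using h m_ge_3 unfolding dominating_2_iff
      by (auto simp: conj_disj_distribL ex_disj_distrib)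
    ultimately show ?thesis unfolding eq using i by (elim insertE) simp_all
  qed
  then show "\<exists>k. k \<noteq> h \<and> (3 - i, k) \<in> {1, 2} \<times> {1, 2} \<and>
      dominating H ({1, 2} \<times> {1, 2} - {(3 - i, k)} \<union> {(i, h)})"
    using i \<open>h \<noteq> 1\<close> by (intro exI[of _ 1]) auto
qed

lemma secure_domination_number_2: "secure_domination_number H = min m 4"
proof (cases "m = 3")
  case True
  have "card {(1::nat, 1::nat), (1, 2), (2, 1)} = min m 4" using True by simp
  then show ?thesis
    using secure_domination_number_eqI[OF secure_dominating_3[OF True]]
      card_secure_dominating_2_ge by simp
next
  case False
  then have "card ({1::nat, 2} \<times> {1::nat, 2}) = min m 4"
    using m_ge_3 by (simp add: card_cartesian_product)
  then show ?thesis
    using secure_domination_number_eqI[OF secure_dominating_4] card_secure_dominating_2_ge by simp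
qed

end

theorem theorem5p2:
  fixes m :: nat
  assumes "m \<ge> 3"
  shows "(\<forall>n::nat. n \<ge> 3 \<longrightarrow>
            secure_domination_number (direct_product (cycle_graph n) (complete_graph m)) = n) \<and>
         (m = 3 \<longrightarrow>
            secure_domination_number (direct_product (cycle_graph 2) (complete_graph m)) = 3) \<and>
         (m \<ge> 4 \<longrightarrow>
            secure_domination_number (direct_product (cycle_graph 2) (complete_graph m)) = 4)"
proof (intro conjI allI impI)
  fix n :: nat assume n: "n \<ge> 3"
  interpret shift_graph "cycle_graph n" "\<lambda>i. if i = n then 1 else i + 1"
      "\<lambda>i. if i = 1 then n else i - 1" m
    using shift_graph_cycle n assms by simp
  have "secure_domination_number H = card (verts (cycle_graph n))"
    by (rule secure_domination_number_eq_card) (use n in \<open>auto simp: cycle_graph_def\<close>)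
  then show "secure_domination_number H = n" by (simp add: cycle_graph_def)
next
  interpret two_layers m
    using assms
    by unfold_locales (auto simp: cycle_graph_def doubleton_eq_iff, presburger+)
  show "secure_domination_number H = 3" if "m = 3"
    using secure_domination_number_2 that by simp
  show "secure_domination_number H = 4" if "m \<ge> 4"
    using secure_domination_number_2 that by simp
qed

end
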